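(* Let $X$ and $Y$ be Hausdorff locally convex topological vector spaces, $\varphi: X\times Y\to\overline{\mathbb{R}}$ a proper convex function, $g_i: X\times Y\to\mathbb{R}$, $i\in I:=\{1,\dots,m\}$, continuous convex functions, $C\subset X\times Y$ a convex set, and, for $j\in J:=\{1,\dots,k\}$, let $h_j(x,y)=\langle(x_j^*,y_j^* ),(x,y)\rangle-\alpha_j$ with $(x_j^*,y_j^* )\in X^*\times Y^*$ and $\alpha_j\in\mathbb{R}$. Let $\mu$ be the optimal value function and $M$ the solution map of the parametric problem $$\min\{\varphi(x,y)\mid (x,y)\in C,\ g_i(x,y)\le 0,\ i\in I,\ h_j(x,y)=0,\ j\in J\}$$ (minimization over $y\in Y$, with parameter $x\in X$). Suppose that $M(\bar x)$ is nonempty for some $\bar x\in{\rm dom}\,\mu$. If $\varphi$ is continuous at a point $(x^0,y^0)\in{\rm int}\,C$ with $g_i(x^0,y^0)<0$ for all $i\in I$ and $h_j(x^0,y^0)=0$ for all $j\in J$, then for any $\bar y\in M(\bar x)$ one has $$\partial^\infty\mu(\bar x)\subset\bigcup_{(\lambda,\nu)\in\Lambda^\infty(\bar x,\bar y)}\partial_x\widehat L(\bar x,\bar y,\lambda,\nu),$$ where $\partial_x\widehat L(\bar x,\bar y,\lambda,\nu)$ stands for the subdifferential of $\widehat L(\cdot,\bar y,\lambda,\nu)$ at $\bar x$.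
   Context: $\overline{\mathbb{R}}=[-\infty,+\infty]$; $X^*,Y^*$ are the topological duals, and $\langle(x^*,y^* ),(x,y)\rangle=\langle x^*,x\rangle+\langle y^*,y\rangle$. A function $f: Z\to\overline{\mathbb{R}}$ is proper if $f>-\infty$ everywhere and ${\rm dom}\,f=\{z\mid f(z)<+\infty\}\neq\emptyset$; convex if its epigraph ${\rm epi}\,f=\{(z,\alpha)\in Z\times\mathbb{R}\mid\alpha\ge f(z)\}$ is convex. "Continuous at a point" means finite-valued and continuous there. For a convex set $\Omega\subset Z$ and $\bar z\in\Omega$, $N(\bar z;\Omega)=\{z^*\in Z^*\mid\langle z^*,z-\bar z\rangle\le 0\ \forall z\in\Omega\}$. For $f$ convex and finite at $\bar z$, the subdifferential is $\partial f(\bar z)=\{z^*\in Z^*\mid\langle z^*,z-\bar z\rangle\le f(z)-f(\bar z)\ \forall z\in Z\}$ and the singular subdifferential is $\partial^\infty f(\bar z)=\{z^*\in Z^*\mid(z^*,0)\in N((\bar z,f(\bar z));{\rm epi}\,f)\}$ (both are $\emptyset$ if $\bar z\notin{\rm dom}\,f$). Let $G(x)=\{y\in Y\mid(x,y)\in C,\ g_i(x,y)\le 0\ \forall i\in I,\ h_j(x,y)=0\ \forall j\in J\}$. Then $\mu(x)=\inf\{\varphi(x,y)\mid y\in G(x)\}$ (with $\inf\emptyset=+\infty$), ${\rm dom}\,\mu=\{x\mid\mu(x)<+\infty\}$, and $M(x)=\{y\in G(x)\mid\mu(x)=\varphi(x,y)\}$. For a set $\Omega$, $\iota_\Omega$ is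 its indicator function ($0$ on $\Omega$, $+\infty$ off $\Omega$). Define $$\widehat L(x,y,\lambda,\nu)=\iota_{{\rm dom}\,\varphi}((x,y))+\sum_{i\in I}\lambda_i g_i(x,y)+\sum_{j\in J}\nu_j h_j(x,y)+\iota_C((x,y)),\quad\lambda\in\mathbb{R}^m,\ \nu\in\mathbb{R}^k.$$ The singular Lagrange multiplier set $\Lambda^\infty(\bar x,\bar y)$ consists of the pairs $(\lambda,\nu)\in\mathbb{R}^m\times\mathbb{R}^k$ such that $0\in\partial_y\widehat L(\bar x,\bar y,\lambda,\nu)$, $\lambda_i g_i(\bar x,\bar y)=0$ and $\lambda_i\ge 0$ for $i=1,\dots,m$, where $\partial_y\widehat L(\bar x,\bar y,\lambda,\nu)$ is the subdifferential of $\widehat L(\bar x,\cdot,\lambda,\nu)$ at $\bar y$. *)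

theory Defs
  imports "HOL-Analysis.Analysis"
begin

text \<open>
  Hausdorff locally convex real topological vector spaces. Continuity of addition comes from
  the superclass; continuity of scalar multiplication is joint continuity.
  The predicate \<open>convex\<close> cannot be used inside a class specification, hence its unfolded form.
\<close>

class hausdorff_lctvs = real_vector + topological_ab_group_add + t2_space +
  assumes tendsto_scaleR_prod:
    "LIM p (nhds c \<times>\<^sub>F nhds z). fst p *\<^sub>R snd p :> nhds (c *\<^sub>R z)"
  assumes convex_nhds_zero:
    "open U \<Longrightarrow> 0 \<in> U \<Longrightarrow> \<exists>V. open V \<and> 0 \<in> V \<and> V \<subseteq> U \<and>
       (\<forall>x\<in>V. \<forall>y\<in>V. \<forall>u\<ge>0. \<forall>v\<ge>0. u + v = 1 \<longrightarrow> u *\<^sub>R x + v *\<^sub>R y \<in> V)"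

definition dual :: "('z :: {real_vector, topological_space} \<Rightarrow> real) set" where
  "dual = {zs. linear zs \<and> continuous_on UNIV zs}"

definition edom :: "('z \<Rightarrow> ereal) \<Rightarrow> 'z set" where
  "edom f = {z. f z < \<infinity>}"

definition proper :: "('z \<Rightarrow> ereal) \<Rightarrow> bool" where
  "proper f \<longleftrightarrow> (\<forall>z. f z > -\<infinity>) \<and> edom f \<noteq> {}"

definition epi :: "('z \<Rightarrow> ereal) \<Rightarrow> ('z \<times> real) set" where
  "epi f = {(z, \<alpha>). ereal \<alpha> \<ge> f z}"

definition econvex :: "('z :: real_vector \<Rightarrow> ereal) \<Rightarrow> bool" where
  "econvex f \<longleftrightarrow> convex (epi f)"

definition econtinuous_at :: "('z :: t2_space \<Rightarrow> ereal) \<Rightarrow> 'z \<Rightarrow> bool" where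
  "econtinuous_at f z \<longleftrightarrow> \<bar>f z\<bar> \<noteq> \<infinity> \<and> isCont f z"

definition normal_cone ::
  "'z :: {real_vector, topological_space} \<Rightarrow> 'z set \<Rightarrow> ('z \<Rightarrow> real) set" where
  "normal_cone zb \<Omega> = {zs \<in> dual. zb \<in> \<Omega> \<and> (\<forall>z\<in>\<Omega>. zs (z - zb) \<le> 0)}"

text \<open>Both subdifferentials are empty at points where the function is not finite.\<close>

definition subdiff ::
  "('z :: {real_vector, topological_space} \<Rightarrow> ereal) \<Rightarrow> 'z \<Rightarrow> ('z \<Rightarrow> real) set" where
  "subdiff f zb = {zs \<in> dual. \<bar>f zb\<bar> \<noteq> \<infinity> \<and> (\<forall>z. ereal (zs (z - zb)) \<le> f z - f zb)}"

text \<open>The functional \<open>(z\<^sup>*, 0)\<close> on \<open>Z \<times> \<real>\<close> is \<open>(z, \<alpha>) \<mapsto> z\<^sup>*(z) + 0 \<sqdot> \<alpha>\<close>.\<close>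

definition sing_subdiff ::
  "('z :: {real_vector, topological_space} \<Rightarrow> ereal) \<Rightarrow> 'z \<Rightarrow> ('z \<Rightarrow> real) set" where
  "sing_subdiff f zb = {zs \<in> dual. \<bar>f zb\<bar> \<noteq> \<infinity> \<and>
     (\<lambda>(z, \<alpha>). zs z + 0 * \<alpha>) \<in> normal_cone (zb, real_of_ereal (f zb)) (epi f)}"

definition iota :: "'z set \<Rightarrow> 'z \<Rightarrow> ereal" where
  "iota \<Omega> z = (if z \<in> \<Omega> then 0 else \<infinity>)"

text \<open>
  The data of the parametric problem: constraint families \<open>g\<close>, \<open>h\<close> are indexed by natural
  numbers and only the indices \<open>1..m\<close> and \<open>1..k\<close>, respectively, are used.
\<close>

definition feasible ::
  "('x \<times> 'y) set \<Rightarrow> nat \<Rightarrow> (nat \<Rightarrow> 'x \<times> 'y \<Rightarrow> real) \<Rightarrow> nat \<Rightarrow> (nat \<Rightarrow> 'x \<times> 'y \<Rightarrow> real)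
    \<Rightarrow> 'x \<Rightarrow> 'y set" where
  "feasible C m g k h x =
     {y. (x, y) \<in> C \<and> (\<forall>i\<in>{1..m}. g i (x, y) \<le> 0) \<and> (\<forall>j\<in>{1..k}. h j (x, y) = 0)}"

definition optval ::
  "('x \<times> 'y \<Rightarrow> ereal) \<Rightarrow> ('x \<times> 'y) set \<Rightarrow> nat \<Rightarrow> (nat \<Rightarrow> 'x \<times> 'y \<Rightarrow> real)
    \<Rightarrow> nat \<Rightarrow> (nat \<Rightarrow> 'x \<times> 'y \<Rightarrow> real) \<Rightarrow> 'x \<Rightarrow> ereal" where
  "optval \<phi> C m g k h x = (INF y \<in> feasible C m g k h x. \<phi> (x, y))"

definition solutions ::
  "('x \<times> 'y \<Rightarrow> ereal) \<Rightarrow> ('x \<times> 'y) set \<Rightarrow> nat \<Rightarrow> (nat \<Rightarrow> 'x \<times> 'y \<Rightarrow> real)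
    \<Rightarrow> nat \<Rightarrow> (nat \<Rightarrow> 'x \<times> 'y \<Rightarrow> real) \<Rightarrow> 'x \<Rightarrow> 'y set" where
  "solutions \<phi> C m g k h x =
     {y \<in> feasible C m g k h x. optval \<phi> C m g k h x = \<phi> (x, y)}"

definition Lhat ::
  "('x \<times> 'y \<Rightarrow> ereal) \<Rightarrow> ('x \<times> 'y) set \<Rightarrow> nat \<Rightarrow> (nat \<Rightarrow> 'x \<times> 'y \<Rightarrow> real)
    \<Rightarrow> nat \<Rightarrow> (nat \<Rightarrow> 'x \<times> 'y \<Rightarrow> real) \<Rightarrow> 'x \<Rightarrow> 'y \<Rightarrow> (nat \<Rightarrow> real) \<Rightarrow> (nat \<Rightarrow> real) \<Rightarrow> ereal" where
  "Lhat \<phi> C m g k h x y l \<nu> =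
     iota (edom \<phi>) (x, y) + ereal (\<Sum>i\<in>{1..m}. l i * g i (x, y))
     + ereal (\<Sum>j\<in>{1..k}. \<nu> j * h j (x, y)) + iota C (x, y)"

text \<open>\<open>\<real>\<^sup>m\<close> and \<open>\<real>\<^sup>k\<close> are the extensional functions on \<open>{1..m}\<close> and \<open>{1..k}\<close>.\<close>

definition sing_multipliers ::
  "('x \<times> ('y :: {real_vector, topological_space}) \<Rightarrow> ereal) \<Rightarrow> ('x \<times> 'y) set
    \<Rightarrow> nat \<Rightarrow> (nat \<Rightarrow> 'x \<times> 'y \<Rightarrow> real) \<Rightarrow> nat \<Rightarrow> (nat \<Rightarrow> 'x \<times> 'y \<Rightarrow> real)
    \<Rightarrow> 'x \<Rightarrow> 'y \<Rightarrow> ((nat \<Rightarrow> real) \<times> (nat \<Rightarrow> real)) set" where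
  "sing_multipliers \<phi> C m g k h xb yb =
     {(l, \<nu>) \<in> ({1..m} \<rightarrow>\<^sub>E UNIV) \<times> ({1..k} \<rightarrow>\<^sub>E UNIV).
        (\<lambda>_. 0) \<in> subdiff (\<lambda>y. Lhat \<phi> C m g k h xb y l \<nu>) yb \<and>
        (\<forall>i\<in>{1..m}. l i * g i (xb, yb) = 0 \<and> l i \<ge> 0)}"

end

theory Submission
  imports Defs
begin

text \<open>
  Let \<open>D\<close> be the convex set of points of \<open>C\<close> at which \<open>\<phi>\<close> is finite. A singular subgradient
  \<open>z\<close> of \<open>\<mu>\<close> at \<open>xb\<close> sees only the domain of \<open>\<mu>\<close>: it satisfies \<open>z (x - xb) \<le> 0\<close> as soon as some
  \<open>(x, y) \<in> D\<close> is feasible. Thus the affine function \<open>(x, y) \<mapsto> - z (x - xb)\<close> is nonnegative on the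
  points of \<open>D\<close> with \<open>g i \<le> 0\<close> and \<open>h j = 0\<close>, and the Slater point lies in the interior of \<open>D\<close>. A
  convex multiplier rule then gives \<open>l \<ge> 0\<close> and \<open>\<nu>\<close> with
  \<open>z (x - xb) \<le> (\<Sum>i\<in>{1..m}. l i * g i (x, y)) + (\<Sum>j\<in>{1..k}. \<nu> j * h j (x, y))\<close> for all
  \<open>(x, y) \<in> D\<close>.
  This single joint inequality contains the whole conclusion. At \<open>(xb, yb)\<close> it forces the
  nonpositive terms \<open>l i * g i (xb, yb)\<close> to vanish; restricted to \<open>x = xb\<close> it says that \<open>0\<close> is a
  subgradient in \<open>y\<close>, and restricted to \<open>y = yb\<close> that \<open>z\<close> is a subgradient in \<open>x\<close>.

  The multiplier rule (\<open>convex_multiplier_rule\<close>) is purely algebraic. Instead of separating convex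
  sets, it removes the constraints one at a time, and each removal
  (\<open>scalar_multiplier\<close>) is the choice of a number between a family of lower bounds and a family of
  upper bounds. Linearly dependent equalities, which can make the hyperplane in a separation
  argument degenerate, cause no trouble in this way: an equality that holds throughout the current
  set gets the multiplier \<open>0\<close>, and any other one changes sign there because every segment of \<open>D\<close>
  ending at the Slater point can be prolonged beyond it.
\<close>

section \<open>Multipliers for a single constraint\<close>

text \<open>
  A multiplier \<open>c\<close> must satisfy \<open>c \<ge> - f z / g z\<close> where \<open>g z > 0\<close> and \<open>c \<le> f w / - g w\<close> where
  \<open>g w < 0\<close>. The assumption \<open>cross\<close> says that every lower bound lies below every upper bound, so the
  infimum of the upper bounds works; the number \<open>b\<close> makes this infimum finite.
\<close>

lemma scalar_multiplier:
  fixes f g :: "'a \<Rightarrow> real"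
  assumes cross: "\<And>z w. \<lbrakk>z \<in> D; w \<in> D; 0 < g z; g w < 0\<rbrakk> \<Longrightarrow> f z * g w \<le> f w * g z"
    and zero: "\<And>z. \<lbrakk>z \<in> D; g z = 0\<rbrakk> \<Longrightarrow> 0 \<le> f z"
    and bound: "\<And>w. \<lbrakk>w \<in> D; g w < 0\<rbrakk> \<Longrightarrow> b * (- g w) \<le> f w"
    and w0: "w0 \<in> D" "g w0 < 0"
  shows "\<exists>c\<ge>b. \<forall>z\<in>D. 0 \<le> f z + c * g z"
proof -
  define U where "U = (\<lambda>w. f w / (- g w)) ` {w \<in> D. g w < 0}"
  have ne: "U \<noteq> {}"
    using w0 unfolding U_def by blast
  have b: "b \<le> u" if "u \<in> U" for u
    using that bound unfolding U_def by (auto simp: pos_le_divide_eq simp del: divide_minus_right)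
  then have bdd: "bdd_below U"
    by (meson bdd_below.I)
  have "0 \<le> f z + Inf U * g z" if z: "z \<in> D" for z
  proof (cases "g z" "0::real" rule: linorder_cases)
    case less
    then have "Inf U \<le> f z / (- g z)"
      using z unfolding U_def by (intro cInf_lower bdd[unfolded U_def]) auto
    then show ?thesis
      using less by (simp add: field_simps)
  next
    case equal
    then show ?thesis
      using zero z by simp
  next
    case greater
    have "- f z / g z \<le> u" if u: "u \<in> U" for u
    proof -
      obtain w where w: "w \<in> D" "g w < 0" "u = f w / (- g w)"
        using u unfolding U_def by blast
      then show ?thesis
        using cross[OF z w(1) greater w(2)] greater
        by (simp add: pos_divide_le_eq pos_le_divide_eq del: divide_minus_right)
    qed
    then have "- f z / g z \<le> Inf U"
      by (intro cInf_greatest ne)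
    then show ?thesis
      using greater by (simp add: field_simps)
  qed
  moreover have "b \<le> Inf U"
    using b by (intro cInf_greatest ne)
  ultimately show ?thesis
    by blast
qed

text \<open>
  The hypothesis \<open>cross\<close> of \<open>scalar_multiplier\<close> comes from the point of the segment at which the
  linear interpolation of \<open>g\<close> vanishes.
\<close>

lemma convex_on_sign_change:
  fixes f g :: "'a :: real_vector \<Rightarrow> real"
  assumes f: "convex_on D f"
    and zw: "z \<in> D" "w \<in> D" "0 < g z" "g w < 0"
    and crossing: "\<And>s t. \<lbrakk>0 \<le> s; 0 \<le> t; s + t = 1; s * g z + t * g w = 0\<rbrakk>
      \<Longrightarrow> 0 \<le> f (s *\<^sub>R z + t *\<^sub>R w)"
  shows "f z * g w \<le> f w * g z"
proof -
  define d s t where "d = g z - g w" and "s = - g w / d" and "t = g z / d"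
  have d: "d > 0"
    using zw by (simp add: d_def)
  have st: "0 \<le> s" "0 \<le> t" "s + t = 1"
    using d zw by (auto simp: s_def t_def field_simps) (auto simp: d_def)
  have "s * g z + t * g w = 0"
    using d by (simp add: s_def t_def field_simps)
  then have "0 \<le> f (s *\<^sub>R z + t *\<^sub>R w)"
    using crossing st by blast
  also have "\<dots> \<le> s * f z + t * f w"
    using f st zw unfolding convex_on_def by blast
  finally have "0 \<le> d * (s * f z + t * f w)"
    using d by simp
  also have "\<dots> = f w * g z - f z * g w"
    using d by (simp add: s_def t_def algebra_simps)
  finally show ?thesis
    by simp
qed

lemma convex_inequality_multiplier:
  fixes f g :: "'a :: real_vector \<Rightarrow> real"
  assumes f: "convex_on D f" and g: "convex_on D g"
    and nonneg: "\<And>z. \<lbrakk>z \<in> D; g z \<le> 0\<rbrakk> \<Longrightarrow> 0 \<le> f z"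
    and slater: "z0 \<in> D" "g z0 < 0"
  shows "\<exists>c\<ge>0. \<forall>z\<in>D. 0 \<le> f z + c * g z"
proof (rule scalar_multiplier[where g = g and ?w0.0 = z0])
  fix z w assume zw: "z \<in> D" "w \<in> D" "0 < g z" "g w < 0"
  show "f z * g w \<le> f w * g z"
  proof (rule convex_on_sign_change[where D = D and f = f and g = g, OF f zw])
    fix s t :: real assume st: "0 \<le> s" "0 \<le> t" "s + t = 1" "s * g z + t * g w = 0"
    have "g (s *\<^sub>R z + t *\<^sub>R w) \<le> s * g z + t * g w"
      using g st zw unfolding convex_on_def by blast
    moreover have "s *\<^sub>R z + t *\<^sub>R w \<in> D"
      using f st zw unfolding convex_on_def convex_def by blast
    ultimately show "0 \<le> f (s *\<^sub>R z + t *\<^sub>R w)"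
      using nonneg st by simp
  qed
qed (use nonneg slater in auto)

text \<open>
  Segments of \<open>D\<close> ending at \<open>z0\<close> can be prolonged beyond \<open>z0\<close> inside \<open>D\<close> (\<open>core\<close>), which is
  interiority of \<open>z0\<close> in the affine hull of \<open>D\<close>, tested along lines. Hence an affine \<open>h\<close> with \<open>h z0 = 0\<close> that is not zero on \<open>D\<close> takes both signs there,
  which bounds the multiplier from below as well as from above.
\<close>

lemma affine_equality_multiplier:
  fixes f h :: "'a :: real_vector \<Rightarrow> real"
  assumes f: "convex_on D f"
    and h: "\<And>u z w. h ((1 - u) *\<^sub>R z + u *\<^sub>R w) = (1 - u) * h z + u * h w"
    and nonneg: "\<And>z. \<lbrakk>z \<in> D; h z = 0\<rbrakk> \<Longrightarrow> 0 \<le> f z"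
    and z0: "h z0 = 0"
    and core: "\<And>z. z \<in> D \<Longrightarrow> \<exists>u<0. (1 - u) *\<^sub>R z0 + u *\<^sub>R z \<in> D"
  shows "\<exists>c. \<forall>z\<in>D. 0 \<le> f z + c * h z"
proof (cases "\<forall>z\<in>D. h z = 0")
  case True
  then show ?thesis
    using nonneg by auto
next
  case False
  then obtain p where p: "p \<in> D" "h p \<noteq> 0"
    by blast
  obtain u where u: "u < 0" "(1 - u) *\<^sub>R z0 + u *\<^sub>R p \<in> D"
    using core p by blast
  define q where "q = (1 - u) *\<^sub>R z0 + u *\<^sub>R p"
  have q: "q \<in> D" "h q = u * h p"
    using u h z0 by (simp_all add: q_def)
  obtain z1 w0 where z1: "z1 \<in> D" "0 < h z1" and w0: "w0 \<in> D" "h w0 < 0"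
  proof (cases "0 < h p")
    case True
    then show ?thesis
      using that[of p q] p q u by (simp add: mult_neg_pos)
  next
    case False
    then show ?thesis
      using that[of q p] p q u by (simp add: mult_neg_neg)
  qed
  have cross: "f z * h w \<le> f w * h z" if zw: "z \<in> D" "w \<in> D" "0 < h z" "h w < 0" for z w
  proof (rule convex_on_sign_change[where D = D and f = f and g = h, OF f zw])
    fix s t :: real assume st: "0 \<le> s" "0 \<le> t" "s + t = 1" "s * h z + t * h w = 0"
    have s: "s = 1 - t"
      using st by simp
    have "h (s *\<^sub>R z + t *\<^sub>R w) = 0"
      unfolding s h using st(4) by (simp add: s)
    moreover have "s *\<^sub>R z + t *\<^sub>R w \<in> D"
      using f st zw unfolding convex_on_def convex_def by blast
    ultimately show "0 \<le> f (s *\<^sub>R z + t *\<^sub>R w)"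
      using nonneg by simp
  qed
  \<comment> \<open>The lower bound for the multiplier is the one imposed by the point \<open>z1\<close>.\<close>
  have "\<exists>c\<ge>- f z1 / h z1. \<forall>z\<in>D. 0 \<le> f z + c * h z"
  proof (rule scalar_multiplier[where g = h and ?w0.0 = w0])
    fix w assume w: "w \<in> D" "h w < 0"
    show "- f z1 / h z1 * (- h w) \<le> f w"
      using cross[OF z1(1) w(1) z1(2) w(2)] z1 by (simp add: field_simps)
  qed (use cross nonneg w0 in auto)
  then show ?thesis
    by blast
qed

section \<open>The convex multiplier rule\<close>

text \<open>
  The set \<open>D\<close> is fixed while the objective varies in the induction: the new constraint is first
  removed on the part of \<open>D\<close> where the old ones hold, and its multiplier then joins the objective.
\<close>

lemma convex_inequalities_multipliers:
  fixes f :: "'a :: real_vector \<Rightarrow> real" and g :: "'i \<Rightarrow> 'a \<Rightarrow> real"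
  assumes "finite I" and "convex_on D f"
    and "\<And>i. i \<in> I \<Longrightarrow> convex_on D (g i)"
    and "\<And>z. \<lbrakk>z \<in> D; \<forall>i\<in>I. g i z \<le> 0\<rbrakk> \<Longrightarrow> 0 \<le> f z"
    and "z0 \<in> D" and "\<And>i. i \<in> I \<Longrightarrow> g i z0 < 0"
  shows "\<exists>l. (\<forall>i\<in>I. 0 \<le> l i) \<and> (\<forall>z\<in>D. 0 \<le> f z + (\<Sum>i\<in>I. l i * g i z))"
  using assms
proof (induction I arbitrary: f rule: finite_induct)
  case empty
  then show ?case
    by auto
next
  case (insert a I)
  define E where "E = {z \<in> D. \<forall>i\<in>I. g i z \<le> 0}"
  have E: "convex E"
  proof (rule convexI)
    fix z w and s t :: real
    assume zw: "z \<in> E" "w \<in> E" and st: "0 \<le> s" "0 \<le> t" "s + t = 1"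
    have "s *\<^sub>R z + t *\<^sub>R w \<in> D"
      using insert.prems(1) zw st unfolding E_def convex_on_def convex_def by blast
    moreover have "g i (s *\<^sub>R z + t *\<^sub>R w) \<le> 0" if i: "i \<in> I" for i
    proof -
      have "g i (s *\<^sub>R z + t *\<^sub>R w) \<le> s * g i z + t * g i w"
        using insert.prems(2)[of i] i zw st unfolding E_def convex_on_def by blast
      also have "\<dots> \<le> 0"
        using i zw st unfolding E_def by (intro add_nonpos_nonpos mult_nonneg_nonpos) auto
      finally show ?thesis .
    qed
    ultimately show "s *\<^sub>R z + t *\<^sub>R w \<in> E"
      unfolding E_def by blast
  qed
  have ED: "E \<subseteq> D"
    by (auto simp: E_def)
  have "\<exists>c\<ge>0. \<forall>z\<in>E. 0 \<le> f z + c * g a z"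
  proof (rule convex_inequality_multiplier)
    show "convex_on E f" "convex_on E (g a)"
      using insert.prems(1,2) ED E by (auto intro: convex_on_subset)
    show "z0 \<in> E"
      using insert.prems(4,5) by (auto simp: E_def less_imp_le)
  qed (use insert.prems in \<open>auto simp: E_def\<close>)
  then obtain c where c: "c \<ge> 0" "\<And>z. z \<in> E \<Longrightarrow> 0 \<le> f z + c * g a z"
    by blast
  have "\<exists>l. (\<forall>i\<in>I. 0 \<le> l i) \<and> (\<forall>z\<in>D. 0 \<le> (f z + c * g a z) + (\<Sum>i\<in>I. l i * g i z))"
  proof (rule insert.IH)
    show "convex_on D (\<lambda>z. f z + c * g a z)"
      using insert.prems c by (intro convex_on_add convex_on_cmul) auto
  qed (use insert.prems c in \<open>auto simp: E_def\<close>)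
  then obtain l where l: "\<forall>i\<in>I. 0 \<le> l i"
    "\<forall>z\<in>D. 0 \<le> (f z + c * g a z) + (\<Sum>i\<in>I. l i * g i z)"
    by blast
  have "(\<Sum>i\<in>I. (l(a := c)) i * g i z) = (\<Sum>i\<in>I. l i * g i z)" for z
    using insert.hyps by (intro sum.cong) auto
  then show ?case
    using insert.hyps l c by (intro exI[of _ "l(a := c)"]) (auto simp: add.assoc)
qed

lemma convex_affine_zeros:
  fixes h :: "'j \<Rightarrow> 'a :: real_vector \<Rightarrow> real"
  assumes D: "convex D"
    and h: "\<And>j u z w. j \<in> J \<Longrightarrow> h j ((1 - u) *\<^sub>R z + u *\<^sub>R w) = (1 - u) * h j z + u * h j w"
  shows "convex {z \<in> D. \<forall>j\<in>J. h j z = 0}"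
  unfolding convex_alt
proof (intro ballI allI impI)
  fix z w and u :: real
  assume zw: "z \<in> {z \<in> D. \<forall>j\<in>J. h j z = 0}" "w \<in> {z \<in> D. \<forall>j\<in>J. h j z = 0}"
    and u: "0 \<le> u \<and> u \<le> 1"
  have "(1 - u) *\<^sub>R z + u *\<^sub>R w \<in> D"
    using D zw u unfolding convex_alt by blast
  then show "(1 - u) *\<^sub>R z + u *\<^sub>R w \<in> {z \<in> D. \<forall>j\<in>J. h j z = 0}"
    using zw h by simp
qed

text \<open>
  The induction is the one for inequalities. The prolongation property of \<open>z0\<close> is inherited by the
  part of \<open>D\<close> where the affine functions vanish, since this part is cut out by a flat through \<open>z0\<close>.
\<close>

lemma affine_equalities_multipliers:
  fixes f :: "'a :: real_vector \<Rightarrow> real" and h :: "'j \<Rightarrow> 'a \<Rightarrow> real"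
  assumes "finite J" and "convex_on D f"
    and "\<And>j u z w. j \<in> J \<Longrightarrow> h j ((1 - u) *\<^sub>R z + u *\<^sub>R w) = (1 - u) * h j z + u * h j w"
    and "\<And>z. \<lbrakk>z \<in> D; \<forall>j\<in>J. h j z = 0\<rbrakk> \<Longrightarrow> 0 \<le> f z"
    and "\<And>j. j \<in> J \<Longrightarrow> h j z0 = 0"
    and "\<And>z. z \<in> D \<Longrightarrow> \<exists>u<0. (1 - u) *\<^sub>R z0 + u *\<^sub>R z \<in> D"
  shows "\<exists>\<nu>. \<forall>z\<in>D. 0 \<le> f z + (\<Sum>j\<in>J. \<nu> j * h j z)"
  using assms
proof (induction J arbitrary: f rule: finite_induct)
  case empty
  then show ?case
    by auto
next
  case (insert a J)
  have affine: "convex_on D (\<lambda>z. c * h a z)" for c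
  proof (rule convex_onI)
    show "convex D"
      using insert.prems(1) by (simp add: convex_on_def)
  next
    fix t z w
    have "h a ((1 - t) *\<^sub>R z + t *\<^sub>R w) = (1 - t) * h a z + t * h a w"
      using insert.prems(2) by blast
    then show "c * h a ((1 - t) *\<^sub>R z + t *\<^sub>R w) \<le> (1 - t) * (c * h a z) + t * (c * h a w)"
      by (simp add: distrib_left)
  qed
  define E where "E = {z \<in> D. \<forall>j\<in>J. h j z = 0}"
  have E: "convex E"
    unfolding E_def using insert.prems(1,2) by (intro convex_affine_zeros) (auto simp: convex_on_def)
  have ED: "E \<subseteq> D"
    by (auto simp: E_def)
  have "\<exists>c. \<forall>z\<in>E. 0 \<le> f z + c * h a z"
  proof (rule affine_equality_multiplier)
    show "convex_on E f"
      using insert.prems(1) ED E by (rule convex_on_subset)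
    fix z assume z: "z \<in> E"
    then obtain u where u: "u < 0" "(1 - u) *\<^sub>R z0 + u *\<^sub>R z \<in> D"
      using insert.prems(5) ED by blast
    then have "(1 - u) *\<^sub>R z0 + u *\<^sub>R z \<in> E"
      using z insert.prems(2,4) by (simp add: E_def)
    with u show "\<exists>u<0. (1 - u) *\<^sub>R z0 + u *\<^sub>R z \<in> E"
      by blast
  qed (use insert.prems in \<open>auto simp: E_def\<close>)
  then obtain c where c: "\<And>z. z \<in> E \<Longrightarrow> 0 \<le> f z + c * h a z"
    by blast
  have "\<exists>\<nu>. \<forall>z\<in>D. 0 \<le> (f z + c * h a z) + (\<Sum>j\<in>J. \<nu> j * h j z)"
  proof (rule insert.IH)
    show "convex_on D (\<lambda>z. f z + c * h a z)"
      using insert.prems(1) affine by (rule convex_on_add)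
  qed (use insert.prems c in \<open>auto simp: E_def\<close>)
  then obtain \<nu> where \<nu>: "\<forall>z\<in>D. 0 \<le> (f z + c * h a z) + (\<Sum>j\<in>J. \<nu> j * h j z)"
    by blast
  have "(\<Sum>j\<in>J. (\<nu>(a := c)) j * h j z) = (\<Sum>j\<in>J. \<nu> j * h j z)" for z
    using insert.hyps by (intro sum.cong) auto
  then show ?case
    using insert.hyps \<nu> by (intro exI[of _ "\<nu>(a := c)"]) (auto simp: add.assoc)
qed

text \<open>
  The inequalities go first, on the part of \<open>D\<close> where the equalities hold. The equalities are then
  removed on all of \<open>D\<close>, so that interiority of \<open>z0\<close> is used for \<open>D\<close> alone and not for the
  set cut out by the inequalities.
\<close>

lemma convex_multiplier_rule:
  fixes f :: "'a :: real_vector \<Rightarrow> real"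
    and g :: "'i \<Rightarrow> 'a \<Rightarrow> real" and h :: "'j \<Rightarrow> 'a \<Rightarrow> real"
  assumes fin: "finite I" "finite J" and f: "convex_on D f"
    and g: "\<And>i. i \<in> I \<Longrightarrow> convex_on D (g i)"
    and h: "\<And>j u z w. j \<in> J \<Longrightarrow> h j ((1 - u) *\<^sub>R z + u *\<^sub>R w) = (1 - u) * h j z + u * h j w"
    and nonneg: "\<And>z. \<lbrakk>z \<in> D; \<forall>i\<in>I. g i z \<le> 0; \<forall>j\<in>J. h j z = 0\<rbrakk> \<Longrightarrow> 0 \<le> f z"
    and z0: "z0 \<in> D" "\<And>i. i \<in> I \<Longrightarrow> g i z0 < 0" "\<And>j. j \<in> J \<Longrightarrow> h j z0 = 0"
    and core: "\<And>z. z \<in> D \<Longrightarrow> \<exists>u<0. (1 - u) *\<^sub>R z0 + u *\<^sub>R z \<in> D"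
  shows "\<exists>l \<nu>. (\<forall>i\<in>I. 0 \<le> l i) \<and>
    (\<forall>z\<in>D. 0 \<le> f z + (\<Sum>i\<in>I. l i * g i z) + (\<Sum>j\<in>J. \<nu> j * h j z))"
proof -
  define E where "E = {z \<in> D. \<forall>j\<in>J. h j z = 0}"
  have D: "convex D"
    using f by (simp add: convex_on_def)
  have E: "convex E"
    unfolding E_def using D h by (rule convex_affine_zeros)
  have ED: "E \<subseteq> D"
    by (auto simp: E_def)
  have "\<exists>l. (\<forall>i\<in>I. 0 \<le> l i) \<and> (\<forall>z\<in>E. 0 \<le> f z + (\<Sum>i\<in>I. l i * g i z))"
  proof (rule convex_inequalities_multipliers)
    show "convex_on E f" "\<And>i. i \<in> I \<Longrightarrow> convex_on E (g i)"
      using f g ED E by (auto intro: convex_on_subset)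
  qed (use fin nonneg z0 in \<open>auto simp: E_def\<close>)
  then obtain l where l: "\<forall>i\<in>I. 0 \<le> l i"
    "\<And>z. z \<in> E \<Longrightarrow> 0 \<le> f z + (\<Sum>i\<in>I. l i * g i z)"
    by blast
  have "\<exists>\<nu>. \<forall>z\<in>D. 0 \<le> (f z + (\<Sum>i\<in>I. l i * g i z)) + (\<Sum>j\<in>J. \<nu> j * h j z)"
  proof (rule affine_equalities_multipliers)
    have "convex_on D (\<lambda>z. \<Sum>i\<in>I. l i * g i z)"
      using fin(1) l(1) g
    proof (induction I rule: finite_induct)
      case empty
      then show ?case
        using D by (simp add: convex_on_def)
    next
      case (insert a I)
      then show ?case
        by (auto intro!: convex_on_add convex_on_cmul)
    qed
    then show "convex_on D (\<lambda>z. f z + (\<Sum>i\<in>I. l i * g i z))"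
      using f by (intro convex_on_add)
  qed (use fin h l z0 core in \<open>auto simp: E_def\<close>)
  then show ?thesis
    using l by blast
qed

section \<open>Domains of extended-valued convex functions\<close>

lemma ereal_less_infinity_le_real:
  "a < \<infinity> \<Longrightarrow> \<exists>r. a \<le> ereal r"
  by (cases a) auto

lemma convex_edom:
  assumes "econvex \<phi>"
  shows "convex (edom \<phi>)"
proof (rule convexI)
  fix z w and s t :: real
  assume zw: "z \<in> edom \<phi>" "w \<in> edom \<phi>" and st: "0 \<le> s" "0 \<le> t" "s + t = 1"
  obtain a b where "\<phi> z \<le> ereal a" "\<phi> w \<le> ereal b"
    using zw ereal_less_infinity_le_real unfolding edom_def by blast
  then have "(z, a) \<in> epi \<phi>" "(w, b) \<in> epi \<phi>"
    by (auto simp: epi_def)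
  then have "s *\<^sub>R (z, a) + t *\<^sub>R (w, b) \<in> epi \<phi>"
    using assms st unfolding econvex_def convex_def by blast
  then have "\<phi> (s *\<^sub>R z + t *\<^sub>R w) \<le> ereal (s * a + t * b)"
    by (simp add: epi_def)
  then show "s *\<^sub>R z + t *\<^sub>R w \<in> edom \<phi>"
    by (auto simp: edom_def less_top[symmetric] top_ereal_def)
qed

lemma tendsto_scaleR_left_lctvs:
  fixes v :: "'z :: hausdorff_lctvs"
  shows "((\<lambda>u. u *\<^sub>R v) \<longlongrightarrow> 0) (at_left 0)"
proof -
  have "filterlim (\<lambda>u. (u, v)) (nhds 0 \<times>\<^sub>F nhds v) (at_left (0::real))"
    by (intro filterlim_Pair tendsto_const tendsto_ident_at)
  from filterlim_compose[OF tendsto_scaleR_prod this] show ?thesis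
    by simp
qed

text \<open>
  This turns topological interiority into the algebraic one of the multiplier rule: by continuity
  of \<open>u \<mapsto> u *\<^sub>R v\<close> at \<open>0\<close> in each factor, a line through \<open>z0\<close> stays in \<open>S\<close> for small \<open>u\<close>, and
  negative \<open>u\<close> are those beyond \<open>z0\<close> as seen from \<open>z\<close>.
\<close>

lemma open_prolongs_segment:
  fixes z0 z :: "'x :: hausdorff_lctvs \<times> 'y :: hausdorff_lctvs"
  assumes "open S" and "z0 \<in> S"
  shows "\<exists>u<0. (1 - u) *\<^sub>R z0 + u *\<^sub>R z \<in> S"
proof -
  have "((\<lambda>u. (fst z0 + u *\<^sub>R (fst z - fst z0), snd z0 + u *\<^sub>R (snd z - snd z0)))
      \<longlongrightarrow> (fst z0 + 0, snd z0 + 0)) (at_left 0)"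
    by (intro tendsto_Pair tendsto_add tendsto_const tendsto_scaleR_left_lctvs)
  then have "\<forall>\<^sub>F u in at_left 0.
      (fst z0 + u *\<^sub>R (fst z - fst z0), snd z0 + u *\<^sub>R (snd z - snd z0)) \<in> S"
    using assms by (intro topological_tendstoD) auto
  moreover have "\<forall>\<^sub>F u in at_left (0::real). u < 0"
    by (rule eventually_at_leftI[of "-1"]) auto
  ultimately have "\<forall>\<^sub>F u in at_left 0. u < 0 \<and>
      (fst z0 + u *\<^sub>R (fst z - fst z0), snd z0 + u *\<^sub>R (snd z - snd z0)) \<in> S"
    by eventually_elim auto
  then obtain u where u: "u < 0"
    "(fst z0 + u *\<^sub>R (fst z - fst z0), snd z0 + u *\<^sub>R (snd z - snd z0)) \<in> S"
    using eventually_happens[of _ "at_left (0::real)"] by auto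
  have "(fst z0 + u *\<^sub>R (fst z - fst z0), snd z0 + u *\<^sub>R (snd z - snd z0))
      = (1 - u) *\<^sub>R z0 + u *\<^sub>R z"
    by (simp add: prod_eq_iff algebra_simps)
  with u show ?thesis
    by auto
qed

lemma econtinuous_at_interior_edom:
  assumes "econtinuous_at \<phi> z0"
  shows "z0 \<in> interior (edom \<phi>)"
proof -
  have "(\<phi> \<longlongrightarrow> \<phi> z0) (at z0)" and fin: "\<phi> z0 < \<infinity>"
    using assms by (auto simp: econtinuous_at_def isCont_def)
  then have "\<forall>\<^sub>F z in at z0. \<phi> z < \<infinity>"
    by (rule order_tendstoD)
  then have "\<forall>\<^sub>F z in nhds z0. \<phi> z < \<infinity>"
    unfolding eventually_at_filter by (rule eventually_mono) (use fin in auto)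
  then show ?thesis
    by (auto simp: eventually_nhds edom_def interior_def)
qed

section \<open>Singular subgradients of the optimal value function\<close>

text \<open>
  Since the second component of a singular subgradient is \<open>0\<close>, the height of the epigraph is
  irrelevant, and it suffices that \<open>\<mu>\<close> has some real upper bound at \<open>x\<close>.
\<close>

lemma sing_subdiff_optval_nonpos:
  assumes "z \<in> sing_subdiff (optval \<phi> C m g k h) xb"
    and "y \<in> feasible C m g k h x" and "(x, y) \<in> edom \<phi>"
  shows "z (x - xb) \<le> 0"
proof -
  have "optval \<phi> C m g k h x \<le> \<phi> (x, y)"
    unfolding optval_def using assms(2) by (rule INF_lower)
  also have "\<dots> < \<infinity>"
    using assms(3) by (simp add: edom_def)
  finally obtain a where "optval \<phi> C m g k h x \<le> ereal a"
    using ereal_less_infinity_le_real by blast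
  then have "(x, a) \<in> epi (optval \<phi> C m g k h)"
    by (simp add: epi_def)
  then show ?thesis
    using assms(1) unfolding sing_subdiff_def normal_cone_def by fastforce
qed

lemma Lhat_eq:
  "Lhat \<phi> C m g k h x y l \<nu> =
    (if (x, y) \<in> edom \<phi> \<inter> C
     then ereal ((\<Sum>i\<in>{1..m}. l i * g i (x, y)) + (\<Sum>j\<in>{1..k}. \<nu> j * h j (x, y))) else \<infinity>)"
  by (auto simp: Lhat_def iota_def)

theorem theorem11:
  fixes \<phi> :: "'x :: hausdorff_lctvs \<times> 'y :: hausdorff_lctvs \<Rightarrow> ereal"
    and C :: "('x \<times> 'y) set"
    and m k :: nat
    and g h :: "nat \<Rightarrow> 'x \<times> 'y \<Rightarrow> real"
    and xs :: "nat \<Rightarrow> 'x \<Rightarrow> real" and ys :: "nat \<Rightarrow> 'y \<Rightarrow> real" and \<alpha> :: "nat \<Rightarrow> real"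
    and xb x0 :: 'x and y0 :: 'y
  assumes "proper \<phi>" and "econvex \<phi>"
    and "\<And>i. i \<in> {1..m} \<Longrightarrow> convex_on UNIV (g i)"
    and "\<And>i. i \<in> {1..m} \<Longrightarrow> continuous_on UNIV (g i)"
    and "convex C"
    and "\<And>j. j \<in> {1..k} \<Longrightarrow> xs j \<in> dual"
    and "\<And>j. j \<in> {1..k} \<Longrightarrow> ys j \<in> dual"
    and "\<And>j x y. j \<in> {1..k} \<Longrightarrow> h j (x, y) = xs j x + ys j y - \<alpha> j"
    and "xb \<in> edom (optval \<phi> C m g k h)"
    and "solutions \<phi> C m g k h xb \<noteq> {}"
    and "econtinuous_at \<phi> (x0, y0)"
    and "(x0, y0) \<in> interior C"
    and "\<And>i. i \<in> {1..m} \<Longrightarrow> g i (x0, y0) < 0"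
    and "\<And>j. j \<in> {1..k} \<Longrightarrow> h j (x0, y0) = 0"
  shows "\<forall>yb \<in> solutions \<phi> C m g k h xb.
    sing_subdiff (optval \<phi> C m g k h) xb \<subseteq>
      (\<Union>(l, \<nu>) \<in> sing_multipliers \<phi> C m g k h xb yb.
         subdiff (\<lambda>x. Lhat \<phi> C m g k h x yb l \<nu>) xb)"
proof (intro ballI subsetI)
  fix yb z
  assume yb: "yb \<in> solutions \<phi> C m g k h xb"
    and z: "z \<in> sing_subdiff (optval \<phi> C m g k h) xb"
  define D where "D = edom \<phi> \<inter> C"
  have z_dual: "z \<in> dual" and "linear z"
    using z by (auto simp: sing_subdiff_def dual_def)
  interpret z: linear z by fact
  have feas: "yb \<in> feasible C m g k h xb" and "\<phi> (xb, yb) = optval \<phi> C m g k h xb"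
    using yb by (auto simp: solutions_def)
  then have b: "(xb, yb) \<in> D"
    using assms(9) by (auto simp: D_def edom_def feasible_def)
  have D: "convex D"
    unfolding D_def using assms(2,5) by (intro convex_Int convex_edom)
  have z0: "(x0, y0) \<in> interior D"
    unfolding D_def using econtinuous_at_interior_edom[OF assms(11)] assms(12) by simp
  have h_affine: "h j ((1 - u) *\<^sub>R p + u *\<^sub>R q) = (1 - u) * h j p + u * h j q"
    if j: "j \<in> {1..k}" for j u and p q :: "'x \<times> 'y"
  proof -
    interpret xs: linear "xs j" using assms(6)[OF j] by (simp add: dual_def)
    interpret ys: linear "ys j" using assms(7)[OF j] by (simp add: dual_def)
    obtain p1 p2 q1 q2 where pq: "p = (p1, p2)" "q = (q1, q2)"
      by fastforce
    show ?thesis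
      unfolding pq scaleR_Pair add_Pair assms(8)[OF j] xs.add ys.add xs.scale ys.scale
      by (simp add: algebra_simps)
  qed
  have "\<exists>l \<nu>. (\<forall>i\<in>{1..m}. 0 \<le> l i) \<and>
    (\<forall>p\<in>D. 0 \<le> - z (fst p - xb) + (\<Sum>i\<in>{1..m}. l i * g i p) + (\<Sum>j\<in>{1..k}. \<nu> j * h j p))"
  proof (rule convex_multiplier_rule[where ?z0.0 = "(x0, y0)"])
    show "convex_on D (\<lambda>p. - z (fst p - xb))"
      using D by (intro convex_onI) (auto simp: z.add z.diff z.scale algebra_simps)
    show "convex_on D (g i)" if "i \<in> {1..m}" for i
      using assms(3)[OF that] D by (auto intro: convex_on_subset)
    show "0 \<le> - z (fst p - xb)"
      if "p \<in> D" "\<forall>i\<in>{1..m}. g i p \<le> 0" "\<forall>j\<in>{1..k}. h j p = 0" for p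
      using sing_subdiff_optval_nonpos[OF z, of "snd p" "fst p"] that
      by (auto simp: D_def feasible_def)
    show "\<exists>u<0. (1 - u) *\<^sub>R (x0, y0) + u *\<^sub>R p \<in> D" for p
      using open_prolongs_segment[OF open_interior z0, of p] interior_subset by blast
    show "(x0, y0) \<in> D"
      using z0 interior_subset by blast
  qed (use h_affine assms(13,14) in simp_all)
  then obtain l \<nu> where l: "\<And>i. i \<in> {1..m} \<Longrightarrow> 0 \<le> l i"
    and multipliers: "\<And>p. p \<in> D \<Longrightarrow>
      0 \<le> - z (fst p - xb) + (\<Sum>i\<in>{1..m}. l i * g i p) + (\<Sum>j\<in>{1..k}. \<nu> j * h j p)"
    by blast
  \<comment> \<open>Multipliers are extensional functions, so the values outside the index sets are discarded.\<close>
  define l' \<nu>' where "l' = restrict l {1..m}" and "\<nu>' = restrict \<nu> {1..k}"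
  have joint: "z (x - xb) \<le>
      (\<Sum>i\<in>{1..m}. l' i * g i (x, y)) + (\<Sum>j\<in>{1..k}. \<nu>' j * h j (x, y))"
    if "(x, y) \<in> D" for x y
    using multipliers[OF that] by (simp add: l'_def \<nu>'_def)
  have terms: "l' i * g i (xb, yb) \<le> 0" if "i \<in> {1..m}" for i
    using that l feas by (auto simp: l'_def feasible_def intro: mult_nonneg_nonpos)
  have h_zero: "(\<Sum>j\<in>{1..k}. \<nu>' j * h j (xb, yb)) = 0"
    using feas by (intro sum.neutral) (auto simp: feasible_def)
  \<comment> \<open>A sum of nonpositive terms that is nonnegative has only zero terms.\<close>
  have g_zero: "(\<Sum>i\<in>{1..m}. l' i * g i (xb, yb)) = 0"
    using joint[OF b] h_zero sum_nonpos[of "{1..m}" "\<lambda>i. l' i * g i (xb, yb)"] terms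
    by (simp add: z.zero)
  then have slack: "l' i * g i (xb, yb) = 0" if "i \<in> {1..m}" for i
    using sum_nonneg_0[of "{1..m}" "\<lambda>i. - (l' i * g i (xb, yb))"] that terms
    by (simp add: sum_negf)
  have Lb: "Lhat \<phi> C m g k h xb yb l' \<nu>' = 0"
    using b g_zero h_zero by (simp add: Lhat_eq D_def)
  have L: "ereal (z (x - xb)) \<le> Lhat \<phi> C m g k h x y l' \<nu>'" for x y
    using joint[of x y] by (auto simp: Lhat_eq D_def)
  have "(\<lambda>_. 0) \<in> subdiff (\<lambda>y. Lhat \<phi> C m g k h xb y l' \<nu>') yb"
    using L[of xb] Lb by (auto simp: subdiff_def dual_def z.zero linear_iff zero_ereal_def)
  moreover have "z \<in> subdiff (\<lambda>x. Lhat \<phi> C m g k h x yb l' \<nu>') xb"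
    using L[of _ yb] Lb z_dual by (auto simp: subdiff_def)
  ultimately have "(l', \<nu>') \<in> sing_multipliers \<phi> C m g k h xb yb"
    and "z \<in> subdiff (\<lambda>x. Lhat \<phi> C m g k h x yb l' \<nu>') xb"
    using slack l by (auto simp: sing_multipliers_def l'_def \<nu>'_def)
  then show "z \<in> (\<Union>(l, \<nu>) \<in> sing_multipliers \<phi> C m g k h xb yb.
      subdiff (\<lambda>x. Lhat \<phi> C m g k h x yb l \<nu>) xb)"
    by blast
qed

end
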